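(* Let $\vec m$ and $(\vec n_k)_{k\in\mathbb N}$ be $n\times n$ difference-bound matrices over $\overline{\mathbb I}$ (with $\mathbb I\in\{\mathbb Z,\mathbb Q,\mathbb R\}$) with non-empty $\mathcal V^0$-domains, and let $i\in\{2,\dots,n\}$. Define $$\vec x_0=\vec m^*,\qquad \vec x_{k+1}=\vec x_k\triangledown(\vec n_k^* ),$$ $$[y_0,z_0]=\pi_{|v_i}(\vec m),\qquad [y_{k+1},z_{k+1}]=[y_k,z_k]\;\overline{\triangledown}\;\pi_{|v_i}(\vec n_k).$$ Then the sequence $(\vec x_k)_{k\in\mathbb N}$ is more precise than the sequence $([y_k,z_k])_{k\in\mathbb N}$ in the following sense: $$\forall k\in\mathbb N,\quad \pi_{|v_i}(\vec x_k)\subseteq[y_k,z_k].$$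
   Context: Let $\mathbb I$ be $\mathbb Z$, $\mathbb Q$ or $\mathbb R$, and $\overline{\mathbb I}=\mathbb I\cup\{+\infty\}$ with the usual extended order and addition. Variables are $v_1,\dots,v_n$, with $v_1$ standing for the constant $0$. A difference-bound matrix (DBM) is an $n\times n$ matrix $\vec m$ with entries in $\overline{\mathbb I}$. Define $\mathcal D(\vec m)=\{(x_1,\dots,x_n)\in\mathbb I^n\;|\;\forall i,j,\ x_j-x_i\leq\vec m_{ij}\}$ and the $\mathcal V^0$-domain $\mathcal D^0(\vec m)=\{(x_2,\dots,x_n)\in\mathbb I^{n-1}\;|\;(0,x_2,\dots,x_n)\in\mathcal D(\vec m)\}$. Closure: for a DBM $\vec m$ with non-empty $\mathcal V^0$-domain, $\vec m^*_{ii}=0$, and for $i\neq j$, $\vec m^*_{ij}$ is the minimum of $\sum_{k=1}^{N-1}\vec m_{i_k i_{k+1}}$ over all finite sequences $i=i_1,i_2,\dots,i_N=j$ of indices. Projection: $\pi_{|v_k}(\vec m)=\{x\in\mathbb I\;|\;\exists(x_2,\dots,x_n)\in\mathcal D^0(\vec m),\ x=x_k\}$. When $\mathcal D^0(\vec m)\neq\emptyset$ this is the interval $[-\vec m^*_{k1},\vec m^*_{1k}]$ of $\mathbb I$. Intervals $[a,b]$ are intervals of $\mathbb I$, with bounds $a\in\mathbb I\cup\{-\infty\}$, $b\in\mathbb I\cup\{+\infty\}$, a bound being included only if finite; $\pi_{|v_i}$ is regarded as an interval with these (tight) bounds. DBM widening: $(\vec m\triangledown\vec n)_{ij}=\vec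 m_{ij}$ if $\vec n_{ij}\leq\vec m_{ij}$, and $+\infty$ otherwise. Interval widening: $[a,b]\;\overline{\triangledown}\;[c,d]=[e,f]$, where $e=a$ if $a\leq c$ and $e=-\infty$ otherwise, and $f=b$ if $b\geq d$ and $f=+\infty$ otherwise. *)

theory Defs
  imports Complex_Main "HOL-Library.Extended_Real" "HOL-Library.FuncSet"
begin

text \<open>
  The number domain is a set \<open>I\<close> of reals, one of the integers, the rationals or all reals.
  An \<open>n \<times> n\<close> matrix is a function whose values matter only at indices in \<open>{1..n}\<close>;
  index \<open>1\<close> is the variable standing for the constant \<open>0\<close>. Since \<open>ereal\<close> also contains
  \<open>-\<infinity>\<close>, which is not allowed as a matrix entry, \<open>dbm\<close> excludes it explicitly.
\<close>

type_synonym matrix = "nat \<Rightarrow> nat \<Rightarrow> ereal"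

definition dbm :: "real set \<Rightarrow> nat \<Rightarrow> matrix \<Rightarrow> bool" where
  "dbm I n m \<longleftrightarrow> (\<forall>i\<in>{1..n}. \<forall>j\<in>{1..n}. m i j \<in> ereal ` I \<union> {\<infinity>})"

definition dbm_domain :: "real set \<Rightarrow> nat \<Rightarrow> matrix \<Rightarrow> (nat \<Rightarrow> real) set" where
  "dbm_domain I n m =
     {v \<in> {1..n} \<rightarrow>\<^sub>E I. \<forall>i\<in>{1..n}. \<forall>j\<in>{1..n}. ereal (v j - v i) \<le> m i j}"

definition dbm_domain0 :: "real set \<Rightarrow> nat \<Rightarrow> matrix \<Rightarrow> (nat \<Rightarrow> real) set" where
  "dbm_domain0 I n m = {v \<in> {2..n} \<rightarrow>\<^sub>E I. v(1 := 0) \<in> dbm_domain I n m}"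

definition path_weight :: "matrix \<Rightarrow> nat list \<Rightarrow> ereal" where
  "path_weight m p = (\<Sum>k<length p - 1. m (p ! k) (p ! Suc k))"

definition paths :: "nat \<Rightarrow> nat \<Rightarrow> nat \<Rightarrow> nat list set" where
  "paths n i j = {p. p \<noteq> [] \<and> set p \<subseteq> {1..n} \<and> hd p = i \<and> last p = j}"

text \<open>
  The \<open>LEAST\<close> below is the minimum over all paths; it is meaningful for matrices with non-empty
  domain, for which the minimum is attained.
\<close>

definition dbm_closure :: "nat \<Rightarrow> matrix \<Rightarrow> matrix" where
  "dbm_closure n m = (\<lambda>i j. if i = j then 0
     else (LEAST w. w \<in> path_weight m ` paths n i j))"

definition dbm_proj :: "real set \<Rightarrow> nat \<Rightarrow> nat \<Rightarrow> matrix \<Rightarrow> real set" where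
  "dbm_proj I n k m = {x \<in> I. \<exists>v \<in> dbm_domain0 I n m. x = v k}"

definition dbm_widen :: "matrix \<Rightarrow> matrix \<Rightarrow> matrix" where
  "dbm_widen m m' = (\<lambda>i j. if m' i j \<le> m i j then m i j else \<infinity>)"

text \<open>
  An interval is represented by its pair of bounds; an infinite bound is never attained because
  the elements of \<open>interval\<close> are real numbers.
\<close>

definition interval :: "real set \<Rightarrow> ereal \<times> ereal \<Rightarrow> real set" where
  "interval I = (\<lambda>(a, b). {x \<in> I. a \<le> ereal x \<and> ereal x \<le> b})"

definition interval_widen :: "ereal \<times> ereal \<Rightarrow> ereal \<times> ereal \<Rightarrow> ereal \<times> ereal" where
  "interval_widen = (\<lambda>(a, b) (c, d).
     (if a \<le> c then a else -\<infinity>, if b \<ge> d then b else \<infinity>))"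

text \<open>
  The projection regarded as an interval, with tight bounds. For a matrix \<open>m\<close> with
  non-empty \<open>dbm_domain0\<close> these bounds are the negated entry \<open>(k, 1)\<close> and the entry
  \<open>(1, k)\<close> of the closure of \<open>m\<close>.
\<close>

definition dbm_proj_interval :: "real set \<Rightarrow> nat \<Rightarrow> nat \<Rightarrow> matrix \<Rightarrow> ereal \<times> ereal" where
  "dbm_proj_interval I n k m =
     (INF x\<in>dbm_proj I n k m. ereal x, SUP x\<in>dbm_proj I n k m. ereal x)"

end

theory Submission
  imports Defs
begin

text \<open>
  For a matrix with a solution \<open>v\<close> the closure gives the tight bounds of the projections: if
  \<open>v b - v a \<le> t \<le> c a b\<close>, where \<open>c\<close> is the closure, then
  \<open>u j = max (v j) (v a + t - c j b)\<close> is again a solution, and \<open>u b - u a = t\<close>.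
  Hence the entries \<open>(1, i)\<close> and \<open>(i, 1)\<close> of the sequence of matrices undergo exactly the
  interval widening, and \<open>z k = x k 1 i\<close>, \<open>y k = - x k i 1\<close> for all \<open>k\<close>.
\<close>

section \<open>Weights of paths\<close>

lemma path_weight_singleton: "path_weight m [a] = 0"
  by (simp add: path_weight_def)

lemma path_weight_Cons: "path_weight m (a # b # p) = m a b + path_weight m (b # p)"
  by (simp add: path_weight_def sum.lessThan_Suc_shift del: sum.lessThan_Suc)

lemma path_weight_append:
  "path_weight m (p @ b # q) = path_weight m (p @ [b]) + path_weight m (b # q)"
proof (induction p)
  case Nil
  then show ?case by (simp add: path_weight_singleton)
next
  case (Cons a p)
  then show ?case by (cases p) (simp_all add: path_weight_Cons path_weight_singleton add.assoc)
qed

text \<open>Non-emptiness of the domain enters as a fixed witness \<open>v\<close>. No normalisation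
  \<open>v 1 = 0\<close> is built in, so \<open>v\<close> serves as a reference point for any pair
  of indices.\<close>

locale solvable_dbm =
  fixes I :: "real set" and n :: nat and m :: matrix and v :: "nat \<Rightarrow> real"
  assumes numbers: "I \<in> {\<int>, \<rat>, \<real>}"
    and matrix: "dbm I n m"
    and solution: "v \<in> dbm_domain I n m"
begin

lemma closed_add: "s \<in> I \<Longrightarrow> t \<in> I \<Longrightarrow> s + t \<in> I"
  and closed_diff: "s \<in> I \<Longrightarrow> t \<in> I \<Longrightarrow> s - t \<in> I"
  and closed_minus: "t \<in> I \<Longrightarrow> - t \<in> I"
  and int_closed: "of_int j \<in> I"
  and zero_closed: "0 \<in> I"
proof -
  have "\<real> = (UNIV :: real set)" by (auto simp: Reals_def)
  then consider "I = \<int>" | "I = \<rat>" | "I = UNIV" using numbers by blast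
  note I_cases = this
  show "s \<in> I \<Longrightarrow> t \<in> I \<Longrightarrow> s + t \<in> I" by (cases rule: I_cases) simp_all
  show "s \<in> I \<Longrightarrow> t \<in> I \<Longrightarrow> s - t \<in> I" by (cases rule: I_cases) simp_all
  show "t \<in> I \<Longrightarrow> - t \<in> I" by (cases rule: I_cases) simp_all
  show "of_int j \<in> I" by (cases rule: I_cases) simp_all
  show "0 \<in> I" by (cases rule: I_cases) simp_all
qed

section \<open>Shortest paths and the closure\<close>

text \<open>Adding the constraints of the edges telescopes to the difference between the endpoints.
  On a cycle that difference is \<open>0\<close>.\<close>

lemma path_weight_lower:
  assumes "u \<in> dbm_domain I n m" "p \<noteq> []" "set p \<subseteq> {1..n}"
  shows "ereal (u (last p) - u (hd p)) \<le> path_weight m p"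
  using assms(2,3)
proof (induction p rule: induct_list012)
  case (3 a b p)
  have "ereal (u b - u a) \<le> m a b"
    using 3 assms(1) by (auto simp: dbm_domain_def)
  moreover have "ereal (u (last (b # p)) - u b) \<le> path_weight m (b # p)"
    using 3 by simp
  ultimately have "ereal (u b - u a) + ereal (u (last (b # p)) - u b) \<le> path_weight m (a # b # p)"
    unfolding path_weight_Cons by (rule add_mono)
  then show ?case by simp
qed (auto simp: path_weight_singleton)

lemma path_weight_in:
  assumes "p \<noteq> []" "set p \<subseteq> {1..n}"
  shows "path_weight m p \<in> ereal ` I \<union> {\<infinity>}"
  using assms
proof (induction p rule: induct_list012)
  case (3 a b p)
  have "m a b \<in> ereal ` I \<union> {\<infinity>}"
    using 3 matrix by (auto simp: dbm_def)
  moreover have "path_weight m (b # p) \<in> ereal ` I \<union> {\<infinity>}"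
    using 3 by simp
  ultimately show ?case
    unfolding path_weight_Cons by (auto simp: closed_add)
qed (auto simp: path_weight_singleton zero_closed)

text \<open>The solution forces cycles to have non-negative weight, so they can be cut out of a path.\<close>

lemma distinct_path:
  assumes "p \<in> paths n a b"
  shows "\<exists>q\<in>paths n a b. distinct q \<and> path_weight m q \<le> path_weight m p"
  using assms
proof (induction p rule: length_induct)
  case (1 p)
  show ?case
  proof (cases "distinct p")
    case False
    then obtain xs ys zs c where p: "p = xs @ [c] @ ys @ [c] @ zs"
      using not_distinct_decomp by blast
    have "ereal (v (last (c # ys @ [c])) - v (hd (c # ys @ [c]))) \<le> path_weight m (c # ys @ [c])"
      using 1 p by (intro path_weight_lower solution) (auto simp: paths_def)
    then have cycle: "0 \<le> path_weight m (c # ys @ [c])" by (simp add: zero_ereal_def)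
    let ?q = "xs @ c # zs"
    have "path_weight m p = path_weight m (xs @ [c]) + path_weight m (c # ys @ c # zs)"
      using path_weight_append[of m xs c "ys @ c # zs"] p by simp
    also have "path_weight m (c # ys @ c # zs)
        = path_weight m (c # ys @ [c]) + path_weight m (c # zs)"
      using path_weight_append[of m "c # ys" c zs] by simp
    also have "path_weight m (xs @ [c]) + \<dots> = path_weight m (c # ys @ [c]) + path_weight m ?q"
      using path_weight_append[of m xs c zs] by (simp add: ac_simps)
    finally have "path_weight m ?q \<le> path_weight m p"
      using add_right_mono[OF cycle, of "path_weight m ?q"] by simp
    moreover have "?q \<in> paths n a b"
      using 1(2) p by (cases xs) (auto simp: paths_def)
    moreover have "length ?q < length p" using p by simp
    ultimately show ?thesis using 1(1) by (meson order.trans)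
  qed (use 1 in blast)
qed

text \<open>Only finitely many paths are free of repetitions, so one of them has least weight; by
  \<open>distinct_path\<close> no other path is lighter.\<close>

lemma shortest_path:
  assumes "a \<in> {1..n}" "b \<in> {1..n}"
  shows "\<exists>p\<in>paths n a b. \<forall>q\<in>paths n a b. path_weight m p \<le> path_weight m q"
proof -
  let ?D = "{p \<in> paths n a b. distinct p}"
  have "finite ?D"
    by (rule finite_subset[OF _ finite_subset_distinct[of "{1..n}"]]) (auto simp: paths_def)
  moreover have "[a, b] \<in> paths n a b" using assms by (auto simp: paths_def)
  \<comment> \<open>For \<open>a = b\<close> the path \<open>[a, b]\<close> itself is not distinct,
    hence the detour through \<open>distinct_path\<close>.\<close>
  then have "?D \<noteq> {}" using distinct_path by blast
  ultimately obtain p where p: "p \<in> ?D" "\<forall>q\<in>?D. path_weight m p \<le> path_weight m q"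
    using ex_is_arg_min_if_finite[of ?D "path_weight m"] by (auto simp: is_arg_min_linorder)
  have "path_weight m p \<le> path_weight m q" if "q \<in> paths n a b" for q
    using distinct_path[OF that] p(2) by (blast intro: order.trans)
  then show ?thesis using p(1) by blast
qed

text \<open>The diagonal, set to \<open>0\<close> by definition, fits the description as a minimum:
  \<open>[a]\<close> has weight \<open>0\<close> and no cycle is negative. Later arguments thus need
  no case \<open>a = b\<close>.\<close>

lemma closure_Least:
  assumes "a \<in> {1..n}" "b \<in> {1..n}"
  shows closure_attained: "\<exists>p\<in>paths n a b. dbm_closure n m a b = path_weight m p"
    and closure_le: "p \<in> paths n a b \<Longrightarrow> dbm_closure n m a b \<le> path_weight m p"
proof -
  have "(\<exists>p\<in>paths n a b. dbm_closure n m a b = path_weight m p) \<and>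
      (\<forall>p\<in>paths n a b. dbm_closure n m a b \<le> path_weight m p)"
  proof (cases "a = b")
    case True
    have "[a] \<in> paths n a a" using assms by (auto simp: paths_def)
    moreover have "0 \<le> path_weight m p" if "p \<in> paths n a a" for p
      using path_weight_lower[OF solution, of p] that by (auto simp: paths_def zero_ereal_def)
    ultimately show ?thesis
      using True by (auto simp: dbm_closure_def path_weight_singleton intro!: bexI[of _ "[a]"])
  next
    case False
    obtain p where p: "p \<in> paths n a b" "\<forall>q\<in>paths n a b. path_weight m p \<le> path_weight m q"
      using shortest_path[OF assms] by blast
    then have "dbm_closure n m a b = path_weight m p"
      using False by (auto simp: dbm_closure_def intro!: Least_equality)
    then show ?thesis using p by auto
  qed
  then show "\<exists>p\<in>paths n a b. dbm_closure n m a b = path_weight m p"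
    and "p \<in> paths n a b \<Longrightarrow> dbm_closure n m a b \<le> path_weight m p" by auto
qed

lemma closure_upper:
  assumes "a \<in> {1..n}" "b \<in> {1..n}" "u \<in> dbm_domain I n m"
  shows "ereal (u b - u a) \<le> dbm_closure n m a b"
proof -
  obtain p where "p \<in> paths n a b" "dbm_closure n m a b = path_weight m p"
    using closure_attained[OF assms(1,2)] by blast
  then show ?thesis using path_weight_lower[OF assms(3), of p] by (auto simp: paths_def)
qed

lemma closure_in:
  assumes "a \<in> {1..n}" "b \<in> {1..n}"
  shows "dbm_closure n m a b \<in> ereal ` I \<union> {\<infinity>}"
proof -
  obtain p where "p \<in> paths n a b" "dbm_closure n m a b = path_weight m p"
    using closure_attained[OF assms] by blast
  then show ?thesis using path_weight_in[of p] by (auto simp: paths_def)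
qed

text \<open>Prepend the edge from \<open>a\<close> to \<open>b\<close> to a shortest path from
  \<open>b\<close> to \<open>d\<close>.\<close>

lemma closure_step:
  assumes "a \<in> {1..n}" "b \<in> {1..n}" "d \<in> {1..n}"
  shows "dbm_closure n m a d \<le> m a b + dbm_closure n m b d"
proof -
  obtain p where p: "p \<in> paths n b d" "dbm_closure n m b d = path_weight m p"
    using closure_attained assms by blast
  then obtain q where q: "p = b # q" by (cases p) (auto simp: paths_def)
  have "a # b # q \<in> paths n a d" using p q assms(1) by (auto simp: paths_def)
  then show ?thesis
    using closure_le[OF assms(1,3)] p q by (metis path_weight_Cons)
qed

section \<open>Solutions attaining the closure bounds\<close>

text \<open>By \<open>closure_step\<close>, the function sending \<open>j\<close> to
  \<open>v a + t - c j\<close> satisfies the constraints where \<open>c\<close> is finite, and a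
  pointwise maximum of two solutions is a solution. At \<open>b\<close> the maximum is
  \<open>v a + t\<close>, as \<open>c b = 0\<close> and \<open>v b - v a \<le> t\<close>; at
  \<open>a\<close> it is \<open>v a\<close>, as \<open>t \<le> c a\<close>.\<close>

lemma solution_attaining:
  assumes a: "a \<in> {1..n}" and b: "b \<in> {1..n}"
    and t: "t \<in> I" "v b - v a \<le> t" "ereal t \<le> dbm_closure n m a b"
  shows "\<exists>u\<in>dbm_domain I n m. u b - u a = t"
proof -
  define c where "c j = dbm_closure n m j b" for j
  \<comment> \<open>If \<open>c j\<close> is infinite, raising the value at \<open>b\<close> forces
    nothing at \<open>j\<close>, so \<open>v j\<close> is kept; \<open>real_of_ereal\<close> would
    wrongly read infinity as \<open>0\<close>. The value \<open>undefined\<close> makes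
    \<open>u\<close> extensional.\<close>
  define u where "u j = (if j \<in> {1..n}
    then if c j = \<infinity> then v j else max (v j) (v a + t - real_of_ereal (c j))
    else undefined)" for j
  have vI: "v j \<in> I" if "j \<in> {1..n}" for j
    using solution that by (auto simp: dbm_domain_def)
  have vm: "ereal (v k - v j) \<le> m j k" if "j \<in> {1..n}" "k \<in> {1..n}" for j k
    using solution that by (auto simp: dbm_domain_def)
  have cI: "\<exists>r\<in>I. c j = ereal r" if "j \<in> {1..n}" "c j \<noteq> \<infinity>" for j
    using closure_in[OF that(1) b] that(2) by (auto simp: c_def)
  have uI: "u j \<in> I" if "j \<in> {1..n}" for j
    using that cI[OF that] vI[OF that] vI[OF a] t(1)
    by (auto simp: u_def max_def intro!: closed_add closed_diff)
  have um: "ereal (u k - u j) \<le> m j k" if j: "j \<in> {1..n}" and k: "k \<in> {1..n}" for j k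
  proof (cases "m j k = \<infinity>")
    case False
    then obtain r where r: "m j k = ereal r"
      using matrix j k unfolding dbm_def by blast
    have vr: "v k - v j \<le> r" using vm[OF j k] r by simp
    have vu: "v j \<le> u j" using j by (simp add: u_def)
    show ?thesis
    proof (cases "c k = \<infinity>")
      case True
      \<comment> \<open>Here \<open>u k = v k\<close>, while \<open>u j\<close> can only exceed
        \<open>v j\<close>.\<close>
      then show ?thesis using r vr vu k by (simp add: u_def)
    next
      case False
      then obtain s where s: "c k = ereal s" using cI[OF k] by auto
      have step: "c j \<le> ereal (r + s)"
        using closure_step[OF j k b] r s by (simp add: c_def)
      \<comment> \<open>An upper bound by a real number rules out the infinite case for
        \<open>c j\<close>.\<close>
      then obtain s' where s': "c j = ereal s'" using cI[OF j] by fastforce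
      then show ?thesis using step s r vr j k by (auto simp: u_def)
    qed
  qed simp
  have "c b = 0" by (simp add: c_def dbm_closure_def)
  then have "u b = v a + t" using t(2) b by (simp add: u_def)
  moreover have "u a = v a"
    using t(3) cI[OF a] a by (auto simp: u_def simp flip: c_def)
  moreover have "u \<in> dbm_domain I n m"
    using uI um by (auto simp: dbm_domain_def u_def[abs_def] intro!: extensionalityI PiE_I)
  ultimately show ?thesis by (intro bexI[of _ u]) auto
qed

section \<open>Projections as intervals\<close>

text \<open>Constraints involve only differences, so a solution may be translated to vanish at index
  \<open>1\<close>.\<close>

lemma domain0_shift:
  assumes u: "u \<in> dbm_domain I n m" and "1 \<le> n"
  shows "(\<lambda>j\<in>{2..n}. u j - u 1) \<in> dbm_domain0 I n m"
proof -
  have "u j \<in> I" if "j \<in> {1..n}" for j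
    using u that by (auto simp: dbm_domain_def)
  then have shift: "u j - u 1 \<in> I" if "j \<in> {1..n}" for j
    using that \<open>1 \<le> n\<close> by (simp add: closed_diff)
  have eq: "(\<lambda>j\<in>{2..n}. u j - u 1)(1 := 0) = (\<lambda>j\<in>{1..n}. u j - u 1)"
    using \<open>1 \<le> n\<close> by (auto simp: fun_eq_iff)
  have "(\<lambda>j\<in>{1..n}. u j - u 1) \<in> dbm_domain I n m"
    using u shift by (auto simp: dbm_domain_def)
  then show ?thesis
    unfolding dbm_domain0_def mem_Collect_eq eq using shift by auto
qed

text \<open>The closure bounds every solution, which gives one inclusion; the other realises each
  admissible \<open>t\<close> by \<open>solution_attaining\<close> and translates the
  result.\<close>

lemma proj_eq_interval:
  assumes i: "i \<in> {2..n}"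
  shows "dbm_proj I n i m = interval I (- dbm_closure n m i 1, dbm_closure n m 1 i)"
proof (intro set_eqI iffI)
  fix t
  have idx: "1 \<in> {1..n}" "i \<in> {1..n}" "i \<noteq> 1" using i by auto
  show "t \<in> interval I (- dbm_closure n m i 1, dbm_closure n m 1 i)" if "t \<in> dbm_proj I n i m"
  proof -
    from that obtain w where t: "t \<in> I" "t = w i" and w: "w(1 := 0) \<in> dbm_domain I n m"
      by (auto simp: dbm_proj_def dbm_domain0_def)
    show ?thesis
      using closure_upper[OF idx(1,2) w] closure_upper[OF idx(2,1) w] t idx(3)
      by (auto simp: interval_def ereal_uminus_le_reorder)
  qed
  show "t \<in> dbm_proj I n i m" if "t \<in> interval I (- dbm_closure n m i 1, dbm_closure n m 1 i)"
  proof -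
    from that have t: "t \<in> I" "ereal t \<le> dbm_closure n m 1 i" "ereal (- t) \<le> dbm_closure n m i 1"
      by (auto simp: interval_def ereal_uminus_le_reorder)
    obtain u where u: "u \<in> dbm_domain I n m" "u i - u 1 = t"
    \<comment> \<open>\<open>solution_attaining\<close> only increases a difference of
      \<open>v\<close>. A smaller \<open>t\<close> is reached by exchanging the indices and
      increasing \<open>v 1 - v i\<close> to \<open>- t\<close>.\<close>
    proof (cases "v i - v 1 \<le> t")
      case True
      then show ?thesis using solution_attaining[OF idx(1,2) t(1) _ t(2)] that by blast
    next
      case False
      then show ?thesis
        using solution_attaining[OF idx(2,1) closed_minus[OF t(1)] _ t(3)] that by fastforce
    qed
    then show ?thesis
      using domain0_shift[OF u(1)] i t(1)
      by (auto simp: dbm_proj_def intro!: bexI[of _ "\<lambda>j\<in>{2..n}. u j - u 1"])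
  qed
qed

lemma unbounded_above: "\<exists>t\<in>I. s \<le> t"
  using int_closed[of "\<lceil>s\<rceil>"] le_of_int_ceiling by blast

text \<open>A finite \<open>b\<close> belongs to the interval, because it lies in \<open>I\<close>
  and \<open>s\<close> shows \<open>a \<le> b\<close>; an infinite \<open>b\<close> is approached by
  elements of the unbounded set \<open>I\<close>.\<close>

lemma Sup_interval:
  assumes s: "s \<in> interval I (a, b)" and b: "b \<in> ereal ` I \<union> {\<infinity>}"
  shows "(SUP t\<in>interval I (a, b). ereal t) = b"
proof (rule antisym)
  show "(SUP t\<in>interval I (a, b). ereal t) \<le> b"
    by (auto simp: interval_def intro: SUP_least)
  have as: "a \<le> ereal s" "ereal s \<le> b" using s by (auto simp: interval_def)
  show "b \<le> (SUP t\<in>interval I (a, b). ereal t)"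
  proof (cases b)
    case (real r)
    then have "r \<in> interval I (a, b)"
      using b as order.trans[OF as] by (auto simp: interval_def)
    then show ?thesis using real by (auto intro: SUP_upper)
  next
    case PInf
    have "ereal B \<le> (SUP t\<in>interval I (a, b). ereal t)" for B
    proof -
      \<comment> \<open>Staying above \<open>s\<close> keeps \<open>t\<close> above the lower bound
        \<open>a\<close>.\<close>
      obtain t where t: "t \<in> I" "max B s \<le> t" using unbounded_above by blast
      then have "ereal s \<le> ereal t" by simp
      then have "t \<in> interval I (a, b)"
        using t(1) PInf order.trans[OF as(1)] by (simp add: interval_def)
      then show ?thesis using t(2) by (intro SUP_upper2[of t]) auto
    qed
    then show ?thesis by (metis ereal_top top_greatest)
  qed (use as in auto)
qed

text \<open>Negation reflects the interval and turns the infimum into a supremum.\<close>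

lemma Inf_interval:
  assumes s: "s \<in> interval I (- a, b)" and a: "a \<in> ereal ` I \<union> {\<infinity>}"
  shows "(INF t\<in>interval I (- a, b). ereal t) = - a"
proof -
  have neg: "uminus ` interval I (- a, b) = interval I (- b, a)"
  proof (intro set_eqI iffI)
    fix t assume "t \<in> interval I (- b, a)"
    then have "- t \<in> interval I (- a, b)"
      by (auto simp: interval_def closed_minus ereal_uminus_le_reorder simp flip: uminus_ereal.simps(1))
    then show "t \<in> uminus ` interval I (- a, b)" by force
  qed (auto simp: interval_def closed_minus ereal_uminus_le_reorder simp flip: uminus_ereal.simps(1))
  have "(SUP t\<in>interval I (- b, a). ereal t) = a"
    using Sup_interval[of "- s" "- b" a] s a neg by blast
  then have "(SUP t\<in>interval I (- a, b). - ereal t) = a"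
    by (simp add: image_image flip: neg)
  then show ?thesis
    using ereal_INF_uminus_eq[of "\<lambda>t. - ereal t"  "interval I (- a, b)"] by simp
qed

lemma proj_interval_closure:
  assumes i: "i \<in> {2..n}"
  shows "dbm_proj_interval I n i m = (- dbm_closure n m i 1, dbm_closure n m 1 i)"
proof -
  have idx: "1 \<in> {1..n}" "i \<in> {1..n}" using i by auto
  have "(\<lambda>j\<in>{2..n}. v j - v 1) \<in> dbm_domain0 I n m"
    using domain0_shift[OF solution] i by simp
  moreover have "w i \<in> dbm_proj I n i m" if "w \<in> dbm_domain0 I n m" for w
    using that i by (auto simp: dbm_proj_def dbm_domain0_def)
  ultimately obtain s where "s \<in> interval I (- dbm_closure n m i 1, dbm_closure n m 1 i)"
    using proj_eq_interval[OF i] by blast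
  then show ?thesis
    using closure_in idx
    by (simp add: dbm_proj_interval_def proj_eq_interval[OF i] Sup_interval Inf_interval)
qed

end

section \<open>Comparison of the two widening sequences\<close>

theorem theorem8:
  fixes I :: "real set" and n i :: nat
    and m :: matrix and ns :: "nat \<Rightarrow> matrix"
    and x :: "nat \<Rightarrow> matrix" and y z :: "nat \<Rightarrow> ereal"
  assumes "I \<in> {\<int>, \<rat>, \<real>}"
    and "dbm I n m" and "dbm_domain0 I n m \<noteq> {}"
    and "\<And>k. dbm I n (ns k)" and "\<And>k. dbm_domain0 I n (ns k) \<noteq> {}"
    and "i \<in> {2..n}"
    and "x 0 = dbm_closure n m"
    and "\<And>k. x (Suc k) = dbm_widen (x k) (dbm_closure n (ns k))"
    and "(y 0, z 0) = dbm_proj_interval I n i m"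
    and "\<And>k. (y (Suc k), z (Suc k))
           = interval_widen (y k, z k) (dbm_proj_interval I n i (ns k))"
  shows "\<forall>k. dbm_proj I n i (x k) \<subseteq> interval I (y k, z k)"
proof -
  have proj: "dbm_proj_interval I n i M = (- dbm_closure n M i 1, dbm_closure n M 1 i)"
    if M: "dbm I n M" "dbm_domain0 I n M \<noteq> {}" for M
  proof -
    obtain v where "v(1 := 0) \<in> dbm_domain I n M"
      using M(2) by (auto simp: dbm_domain0_def)
    then interpret solvable_dbm I n M "v(1 := 0)"
      using assms(1) M(1) by unfold_locales
    show ?thesis using assms(6) by (rule proj_interval_closure)
  qed
  \<comment> \<open>Matrix widening acts entrywise. Negating the entry \<open>(i, 1)\<close> turns
    its test into the one for lower bounds and infinity into \<open>-\<infinity>\<close>.\<close>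
  have bounds: "y k = - x k i 1 \<and> z k = x k 1 i" for k
  proof (induction k)
    case 0
    then show ?case using assms(7,9) proj[OF assms(2,3)] by simp
  next
    case (Suc k)
    then show ?case
      using assms(8)[of k] assms(10)[of k] proj[OF assms(4,5), of k]
      by (auto simp: interval_widen_def dbm_widen_def)
  qed
  show ?thesis
  proof (intro allI subsetI)
    \<comment> \<open>A widened matrix may fail to be closed, so its entries need not be tight. They
      still bound the projection directly, which gives the inclusion.\<close>
    fix k t assume "t \<in> dbm_proj I n i (x k)"
    then obtain w where t: "t \<in> I" "t = w i" and w: "w(1 := 0) \<in> dbm_domain I n (x k)"
      by (auto simp: dbm_proj_def dbm_domain0_def)
    have "1 \<in> {1..n}" "i \<in> {1..n}" "i \<noteq> 1" using assms(6) by auto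
    then have "ereal t \<le> x k 1 i" "ereal (- t) \<le> x k i 1"
      using w t(2) by (force simp: dbm_domain_def)+
    then show "t \<in> interval I (y k, z k)"
      using bounds[of k] t(1) by (auto simp: interval_def ereal_uminus_le_reorder)
  qed
qed

end
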